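(* Let $\alpha>0$, let $w,b\in\mathbb{C}$ with $0<|w|\le 1$, and assume $b=0$ if $|w|=1$. Let $\varphi(z)=wz+b$ for $z\in\mathbb{C}$, and let $C_\varphi$ be the (bounded) composition operator $C_\varphi f=f\circ\varphi$ on the Fock space $F^2_\alpha$. Then the set of extended eigenvalues of $C_\varphi$ is $$\mathrm{Ext}(C_\varphi)=\{w^n : n\in\mathbb{Z}\}.$$
   Context: For $\alpha>0$, the Fock space $F^2_\alpha$ is the Hilbert space of entire functions $f:\mathbb{C}\to\mathbb{C}$ with $\|f\|^2=\frac{\alpha}{\pi}\int_{\mathbb{C}}|f(z)|^2e^{-\alpha|z|^2}\,dA(z)<\infty$, where $dA$ is Lebesgue area measure. For a bounded linear operator $A$ on a complex Hilbert space $H$, a scalar $\lambda\in\mathbb{C}$ is an extended eigenvalue of $A$ if there is a nonzero bounded linear operator $X$ on $H$ with $AX=\lambda XA$; $\mathrm{Ext}(A)$ denotes the set of all extended eigenvalues of $A$. *)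

theory Defs
  imports "HOL-Complex_Analysis.Complex_Analysis"
begin

definition fock_space :: "real \<Rightarrow> (complex \<Rightarrow> complex) set" where
  "fock_space \<alpha> = {f. f holomorphic_on UNIV \<and>
     integrable lborel (\<lambda>z. (cmod (f z))\<^sup>2 * exp (- \<alpha> * (cmod z)\<^sup>2))}"

definition fock_norm :: "real \<Rightarrow> (complex \<Rightarrow> complex) \<Rightarrow> real" where
  "fock_norm \<alpha> f =
     sqrt (\<alpha> / pi * (LINT z|lborel. (cmod (f z))\<^sup>2 * exp (- \<alpha> * (cmod z)\<^sup>2)))"

text \<open>
  Since the Fock space depends on the real parameter \<open>\<alpha>\<close>, it is not a type; Hilbert spaces of
  complex-valued functions are represented by a carrier \<open>H\<close> and a norm \<open>N\<close> on it, with pointwise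
  operations. Operators are total HOL functions of which only the values on \<open>H\<close> matter.
\<close>

definition bounded_operator_on ::
  "('a \<Rightarrow> complex) set \<Rightarrow> (('a \<Rightarrow> complex) \<Rightarrow> real)
    \<Rightarrow> (('a \<Rightarrow> complex) \<Rightarrow> ('a \<Rightarrow> complex)) \<Rightarrow> bool" where
  "bounded_operator_on H N T \<longleftrightarrow>
     (\<forall>f\<in>H. T f \<in> H) \<and>
     (\<forall>f\<in>H. \<forall>g\<in>H. T (\<lambda>x. f x + g x) = (\<lambda>x. T f x + T g x)) \<and>
     (\<forall>c. \<forall>f\<in>H. T (\<lambda>x. c * f x) = (\<lambda>x. c * T f x)) \<and>
     (\<exists>K. \<forall>f\<in>H. N (T f) \<le> K * N f)"

text \<open>\<open>Ext H N A\<close> is intended for \<open>A\<close> with \<open>bounded_operator_on H N A\<close>.\<close>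

definition Ext ::
  "('a \<Rightarrow> complex) set \<Rightarrow> (('a \<Rightarrow> complex) \<Rightarrow> real)
    \<Rightarrow> (('a \<Rightarrow> complex) \<Rightarrow> ('a \<Rightarrow> complex)) \<Rightarrow> complex set" where
  "Ext H N A = {l. \<exists>X. bounded_operator_on H N X \<and>
     (\<exists>f\<in>H. X f \<noteq> (\<lambda>x. 0)) \<and>
     (\<forall>f\<in>H. A (X f) = (\<lambda>x. l * X (A f) x))}"

definition composition_operator :: "('a \<Rightarrow> 'a) \<Rightarrow> ('a \<Rightarrow> complex) \<Rightarrow> ('a \<Rightarrow> complex)" where
  "composition_operator \<phi> f = f \<circ> \<phi>"

end

theory Submission
  imports Defs "HOL-Probability.Distributions"
begin

text \<open>
  The affine map \<open>\<phi>\<close> has a fixed point \<open>p\<close>, and the shifted monomials \<open>e\<^sub>n(z) = (z - p)\<^sup>n\<close> are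
  eigenvectors of the composition operator \<open>A\<close> with eigenvalues \<open>w\<^sup>n\<close>. Dually, differentiating
  \<open>f \<circ> \<phi>\<close> at the fixed point shows that the functional \<open>f \<mapsto> (deriv ^^ n) f p\<close> is an eigenvector of the
  transpose of \<open>A\<close> with eigenvalue \<open>w\<^sup>n\<close>.

  Every integer power of \<open>w\<close> is an extended eigenvalue: if \<open>X\<close> is the rank-one operator
  \<open>f \<mapsto> (deriv ^^ n) f p * e\<^sub>m\<close>, then \<open>A X = w\<^sup>m X\<close> and \<open>X A = w\<^sup>n X\<close>, so \<open>A X = w\<^sup>m\<^sup>-\<^sup>n X A\<close>.

  Conversely, let \<open>A X = l X A\<close> with \<open>X \<noteq> 0\<close>. Then \<open>g = X e\<^sub>n\<close> satisfies \<open>A g = l w\<^sup>n g\<close>. Some such \<open>g\<close>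
  is nonzero, because the \<open>e\<^sub>n\<close> span the polynomials and these are dense. A nonzero entire \<open>g\<close> has some
  nonvanishing derivative of order \<open>m\<close> at \<open>p\<close>, and comparing the \<open>m\<close>-th derivatives of both sides at
  \<open>p\<close> gives \<open>w\<^sup>m = l w\<^sup>n\<close>. This covers \<open>|w| < 1\<close> and \<open>|w| = 1\<close> alike.

  Two facts about the Fock space are needed: the functionals \<open>f \<mapsto> (deriv ^^ n) f p\<close> are bounded
  (\<open>higher_deriv_functional_bounded\<close>) and the polynomials are dense
  (\<open>polynomials_dense_in_fock_space\<close>). Both come from one source, Bessel's inequality for Taylor
  coefficients in \<open>L\<^sup>2\<close> of the plane with a radial weight (\<open>bessel\<close>). For the first the
  weight is the indicator of a disc, for the second it is the Gaussian. Monomials are orthogonal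
  for a radial weight because area measure is rotation invariant.
\<close>

section \<open>Rotation invariance of area measure\<close>

lemma distr_lborel_Complex:
  "distr (lborel \<Otimes>\<^sub>M lborel) borel (\<lambda>(x, y). Complex x y) = lborel"
proof (rule lborel_eqI[symmetric])
  have meas [measurable]: "(\<lambda>(x, y). Complex x y) \<in> borel_measurable (borel \<Otimes>\<^sub>M borel)"
    unfolding case_prod_unfold Complex_eq by measurable
  show "sets (distr (lborel \<Otimes>\<^sub>M lborel) borel (\<lambda>(x, y). Complex x y)) = sets borel"
    by simp
  fix l u :: complex
  assume le: "\<And>b. b \<in> Basis \<Longrightarrow> l \<bullet> b \<le> u \<bullet> b"
  have *: "Re l \<le> Re u" "Im l \<le> Im u"
    using le[of 1] le[of \<i>] by (auto simp: Basis_complex_def)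
  have "(\<lambda>(x, y). Complex x y) -` box l u = {Re l<..<Re u} \<times> {Im l<..<Im u}"
    by (auto simp: in_box_complex_iff)
  then have "emeasure (distr (lborel \<Otimes>\<^sub>M lborel) borel (\<lambda>(x, y). Complex x y)) (box l u)
      = emeasure (lborel \<Otimes>\<^sub>M lborel) ({Re l<..<Re u} \<times> {Im l<..<Im u})"
    by (subst emeasure_distr) (auto simp: space_pair_measure)
  also have "\<dots> = ennreal (Re u - Re l) * ennreal (Im u - Im l)"
    using * by (subst lborel.emeasure_pair_measure_Times) auto
  also have "\<dots> = (\<Prod>b\<in>Basis. (u - l) \<bullet> b)"
    using * by (simp add: Basis_complex_def ennreal_mult'' )
  finally show "emeasure (distr (lborel \<Otimes>\<^sub>M lborel) borel (\<lambda>(x, y). Complex x y)) (box l u)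
      = ennreal (\<Prod>b\<in>Basis. (u - l) \<bullet> b)" .
qed

lemma nn_integral_complex_iterated:
  assumes F [measurable]: "F \<in> borel_measurable borel"
  shows "(\<integral>\<^sup>+ z. F z \<partial>lborel) = (\<integral>\<^sup>+ x. \<integral>\<^sup>+ y. F (Complex x y) \<partial>lborel \<partial>lborel)"
    and "(\<integral>\<^sup>+ z. F z \<partial>lborel) = (\<integral>\<^sup>+ y. \<integral>\<^sup>+ x. F (Complex x y) \<partial>lborel \<partial>lborel)"
proof -
  have meas [measurable]: "(\<lambda>(x, y). Complex x y) \<in> borel_measurable (borel \<Otimes>\<^sub>M borel)"
    unfolding case_prod_unfold Complex_eq by measurable
  have "(\<integral>\<^sup>+ z. F z \<partial>lborel) = (\<integral>\<^sup>+ z. F z \<partial>distr (lborel \<Otimes>\<^sub>M lborel) borel (\<lambda>(x, y). Complex x y))"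
    by (simp add: distr_lborel_Complex)
  also have "\<dots> = (\<integral>\<^sup>+ p. (case p of (x, y) \<Rightarrow> F (Complex x y)) \<partial>(lborel \<Otimes>\<^sub>M lborel))"
    by (subst nn_integral_distr) (auto simp: case_prod_unfold)
  finally have *: "(\<integral>\<^sup>+ z. F z \<partial>lborel) = (\<integral>\<^sup>+ p. (case p of (x, y) \<Rightarrow> F (Complex x y)) \<partial>(lborel \<Otimes>\<^sub>M lborel))" .
  have [measurable]: "(\<lambda>(x, y). F (Complex x y)) \<in> borel_measurable (borel \<Otimes>\<^sub>M borel)"
    using measurable_compose[OF meas F] by (simp add: case_prod_beta)
  show "(\<integral>\<^sup>+ z. F z \<partial>lborel) = (\<integral>\<^sup>+ x. \<integral>\<^sup>+ y. F (Complex x y) \<partial>lborel \<partial>lborel)"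
    unfolding * by (subst lborel.nn_integral_fst[symmetric]) (auto simp: case_prod_beta)
  show "(\<integral>\<^sup>+ z. F z \<partial>lborel) = (\<integral>\<^sup>+ y. \<integral>\<^sup>+ x. F (Complex x y) \<partial>lborel \<partial>lborel)"
    unfolding * by (subst lborel_pair.nn_integral_snd[symmetric]) (auto simp: case_prod_beta)
qed

text \<open>
  With \<open>\<omega> = a + \<i> b\<close>, the substitution \<open>u = a x - b y\<close> for fixed \<open>y\<close>, followed by \<open>v = (y + b u) / a\<close> for
  fixed \<open>u\<close>, reduces the claim to two affine substitutions on the line: their factors \<open>1 / |a|\<close> and
  \<open>|a|\<close> cancel, and \<open>v = b x + a y\<close> by \<open>a\<^sup>2 + b\<^sup>2 = 1\<close>. This factorization is available whenever
  \<open>a \<noteq> 0\<close>.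
\<close>

lemma nn_integral_complex_rotate:
  fixes \<omega> :: complex
  assumes F [measurable]: "F \<in> borel_measurable borel"
    and \<omega>: "cmod \<omega> = 1" "Re \<omega> \<noteq> 0"
  shows "(\<integral>\<^sup>+ z. F (\<omega> * z) \<partial>lborel) = (\<integral>\<^sup>+ z. F z \<partial>lborel)"
proof -
  define a b where "a = Re \<omega>" and "b = Im \<omega>"
  have a: "a \<noteq> 0" and ab: "a\<^sup>2 + b\<^sup>2 = 1"
    using \<omega> by (auto simp: a_def b_def cmod_def)
  have C [measurable]: "(\<lambda>x. F (Complex (f x) (g x))) \<in> borel_measurable borel"
    if [measurable]: "f \<in> borel_measurable borel" "g \<in> borel_measurable borel" for f g :: "real \<Rightarrow> real"
    by (simp add: Complex_eq)
  have \<omega>z: "\<omega> * Complex x y = Complex (a * x - b * y) (b * x + a * y)" for x y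
    by (simp add: complex_eq_iff a_def b_def)
  have x_subst: "(\<integral>\<^sup>+ x. F (\<omega> * Complex x y) \<partial>lborel)
      = ennreal (1 / \<bar>a\<bar>) * (\<integral>\<^sup>+ u. F (Complex u ((y + b * u) / a)) \<partial>lborel)" for y
  proof -
    have eq: "\<omega> * Complex (b * y / a + 1 / a * u) y = Complex u ((y + b * u) / a)" for u
    proof -
      have "b * (b * y / a + 1 / a * u) + a * y = ((a\<^sup>2 + b\<^sup>2) * y + b * u) / a"
        using a by (simp add: field_simps power2_eq_square)
      then show ?thesis
        using a ab by (simp add: \<omega>z distrib_left)
    qed
    have "(\<integral>\<^sup>+ x. F (\<omega> * Complex x y) \<partial>lborel)
        = ennreal \<bar>1 / a\<bar> * (\<integral>\<^sup>+ u. F (\<omega> * Complex (b * y / a + 1 / a * u) y) \<partial>lborel)"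
      using a by (intro nn_integral_real_affine) (auto simp: \<omega>z)
    then show ?thesis
      by (simp only: eq) simp
  qed
  have y_subst: "(\<integral>\<^sup>+ y. F (Complex u ((y + b * u) / a)) \<partial>lborel)
      = ennreal \<bar>a\<bar> * (\<integral>\<^sup>+ v. F (Complex u v) \<partial>lborel)" for u
  proof -
    have "(\<integral>\<^sup>+ y. F (Complex u ((y + b * u) / a)) \<partial>lborel)
        = ennreal \<bar>a\<bar> * (\<integral>\<^sup>+ v. F (Complex u ((- b * u + a * v + b * u) / a)) \<partial>lborel)"
      using a by (intro nn_integral_real_affine) auto
    then show ?thesis
      using a by simp
  qed
  have [measurable]: "(\<lambda>(y, u). F (Complex u ((y + b * u) / a))) \<in> borel_measurable (borel \<Otimes>\<^sub>M borel)"
    by (simp add: Complex_eq case_prod_beta)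
  have "(\<integral>\<^sup>+ z. F (\<omega> * z) \<partial>lborel) = (\<integral>\<^sup>+ y. \<integral>\<^sup>+ x. F (\<omega> * Complex x y) \<partial>lborel \<partial>lborel)"
    by (rule nn_integral_complex_iterated(2)) simp
  also have "\<dots> = ennreal (1 / \<bar>a\<bar>) * (\<integral>\<^sup>+ y. \<integral>\<^sup>+ u. F (Complex u ((y + b * u) / a)) \<partial>lborel \<partial>lborel)"
    unfolding x_subst by (rule nn_integral_cmult) simp
  also have "(\<integral>\<^sup>+ y. \<integral>\<^sup>+ u. F (Complex u ((y + b * u) / a)) \<partial>lborel \<partial>lborel)
      = (\<integral>\<^sup>+ u. \<integral>\<^sup>+ y. F (Complex u ((y + b * u) / a)) \<partial>lborel \<partial>lborel)"
    by (rule lborel_pair.Fubini') simp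
  also have "\<dots> = ennreal \<bar>a\<bar> * (\<integral>\<^sup>+ u. \<integral>\<^sup>+ v. F (Complex u v) \<partial>lborel \<partial>lborel)"
    unfolding y_subst
    by (rule nn_integral_cmult) (simp add: Complex_eq)
  also have "(\<integral>\<^sup>+ u. \<integral>\<^sup>+ v. F (Complex u v) \<partial>lborel \<partial>lborel) = (\<integral>\<^sup>+ z. F z \<partial>lborel)"
    by (rule nn_integral_complex_iterated(1)[symmetric]) simp
  finally show ?thesis
    using a by (simp add: mult.assoc[symmetric] ennreal_mult'[symmetric])
qed

lemma distr_lborel_rotate:
  fixes \<omega> :: complex
  assumes "cmod \<omega> = 1" "Re \<omega> \<noteq> 0"
  shows "distr lborel borel ((*) \<omega>) = lborel"
proof (rule measure_eqI)
  fix A assume "A \<in> sets (distr lborel borel ((*) \<omega>))"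
  then have A [measurable]: "A \<in> sets borel" by simp
  have "emeasure (distr lborel borel ((*) \<omega>)) A = (\<integral>\<^sup>+ z. indicator A (\<omega> * z) \<partial>lborel)"
    by (subst nn_integral_distr[symmetric, of _ _ borel]) auto
  also have "\<dots> = (\<integral>\<^sup>+ z. indicator A z \<partial>lborel)"
    using assms by (intro nn_integral_complex_rotate) auto
  finally show "emeasure (distr lborel borel ((*) \<omega>)) A = emeasure lborel A"
    by simp
qed simp

section \<open>Bessel's inequality for radial weights\<close>

lemma borel_measurable_cnj [measurable]: "cnj \<in> borel_measurable borel"
  by (intro borel_measurable_continuous_onI continuous_intros)

text \<open>
  The moment condition puts all polynomials into the weighted \<open>L\<^sup>2\<close> space.
\<close>

locale radial_weight =
  fixes v :: "complex \<Rightarrow> real"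
  assumes measurable_weight [measurable]: "v \<in> borel_measurable borel"
    and weight_nonneg: "v z \<ge> 0"
    and radial: "cmod z = cmod z' \<Longrightarrow> v z = v z'"
    and integrable_moment: "integrable lborel (\<lambda>z. cmod z ^ k * v z)"
begin

text \<open>
  The squared norm of \<open>z\<^sup>n\<close> in the weighted \<open>L\<^sup>2\<close> space.
\<close>

definition moment :: "nat \<Rightarrow> real" where
  "moment n = (LINT z|lborel. cmod z ^ (2 * n) * v z)"

lemma moment_nonneg: "moment n \<ge> 0"
  unfolding moment_def by (intro integral_nonneg_AE) (auto simp: weight_nonneg)

lemma integrable_monomial_product:
  "integrable lborel (\<lambda>z. z ^ n * cnj z ^ m * of_real (v z))"
  by (rule Bochner_Integration.integrable_bound[OF integrable_moment[of "n + m"]])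
     (auto simp: norm_mult norm_power power_add weight_nonneg)

text \<open>
  A rotation by \<open>\<theta>\<close> leaves the integral unchanged but multiplies the integrand by
  \<open>cis ((n - m) * \<theta>)\<close>, so the integral vanishes once this factor differs from \<open>1\<close>.
\<close>

lemma integral_monomial_product:
  "(LINT z|lborel. z ^ n * cnj z ^ m * of_real (v z)) = (if n = m then of_real (moment n) else 0)"
proof (cases "n = m")
  case True
  have "z ^ n * cnj z ^ m * of_real (v z) = of_real (cmod z ^ (2 * n) * v z)" for z
    using True by (simp add: power_mult_distrib[symmetric] complex_norm_square[symmetric] power_mult
        del: complex_mult_cnj mult_cancel_right)
  then have "(LINT z|lborel. z ^ n * cnj z ^ m * of_real (v z)) = of_real (moment n)"
    by (simp only: moment_def integral_complex_of_real)
  then show ?thesis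
    using True by simp
next
  case False
  define g where "g z = z ^ n * cnj z ^ m * of_real (v z)" for z
  define d where "d = real n - real m"
  \<comment> \<open>The angle makes the phase factor \<open>cis (pi / 3) \<noteq> 1\<close>; since \<open>|\<theta>| \<le> pi / 3\<close>, the rotation
    has nonzero real part.\<close>
  define \<theta> where "\<theta> = pi / 3 / d"
  have d: "1 \<le> \<bar>d\<bar>"
    using False unfolding d_def by linarith
  then have d\<theta>: "d * \<theta> = pi / 3"
    by (auto simp: \<theta>_def)
  have "\<bar>\<theta>\<bar> \<le> \<bar>d\<bar> * \<bar>\<theta>\<bar>"
    using mult_right_mono[OF d, of "\<bar>\<theta>\<bar>"] by simp
  then have "\<bar>\<theta>\<bar> \<le> pi / 3"
    by (simp only: abs_mult[symmetric] d\<theta>) simp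
  then have cos: "cos \<theta> > 0"
    using pi_gt_zero by (intro cos_gt_zero_pi; linarith)
  have "cis \<theta> ^ n * cnj (cis \<theta>) ^ m = cis (real n * \<theta> - real m * \<theta>)"
    by (simp add: cis_cnj Complex.DeMoivre cis_mult)
  also have "real n * \<theta> - real m * \<theta> = d * \<theta>"
    by (simp add: d_def left_diff_distrib)
  also have "\<dots> = pi / 3"
    by (rule d\<theta>)
  finally have phase: "cis \<theta> ^ n * cnj (cis \<theta>) ^ m = cis (pi / 3)" .
  have "v (cis \<theta> * z) = v z" for z
    by (rule radial) (simp add: norm_mult)
  then have "g (cis \<theta> * z) = (cis \<theta> ^ n * cnj (cis \<theta>) ^ m) * g z" for z
    by (simp add: g_def power_mult_distrib mult_ac)
  then have rot: "g (cis \<theta> * z) = cis (pi / 3) * g z" for z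
    by (simp only: phase)
  have "(LINT z|lborel. g z) = (LINT z|distr lborel borel ((*) (cis \<theta>)). g z)"
    using cos by (subst distr_lborel_rotate) auto
  also have "\<dots> = (LINT z|lborel. g (cis \<theta> * z))"
    by (rule integral_distr) (auto simp: g_def)
  also have "\<dots> = cis (pi / 3) * (LINT z|lborel. g z)"
    by (simp add: rot)
  finally have "(1 - cis (pi / 3)) * (LINT z|lborel. g z) = 0"
    by (simp add: algebra_simps)
  moreover have "cis (pi / 3) \<noteq> 1"
    by (simp add: complex_eq_iff cos_60)
  ultimately show ?thesis
    using False by (simp add: g_def)
qed

text \<open>
  Parseval's identity for the orthogonal system of monomials.
\<close>

lemma has_bochner_integral_polynomial:
  assumes "finite A"
  shows "has_bochner_integral lborel (\<lambda>z. (cmod (\<Sum>n\<in>A. a n * z ^ n))\<^sup>2 * v z)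
           (\<Sum>n\<in>A. (cmod (a n))\<^sup>2 * moment n)"
proof -
  have expand: "complex_of_real ((cmod (\<Sum>n\<in>A. a n * z ^ n))\<^sup>2 * v z)
      = (\<Sum>n\<in>A. \<Sum>m\<in>A. a n * cnj (a m) * (z ^ n * cnj z ^ m * of_real (v z)))" for z
    unfolding of_real_mult complex_norm_square cnj_sum complex_cnj_mult complex_cnj_power
      sum_product
    unfolding sum_distrib_right
    by (intro sum.cong refl) (simp add: mult_ac)
  have term_integral: "has_bochner_integral lborel (\<lambda>z. z ^ n * cnj z ^ m * of_real (v z))
      (if n = m then of_real (moment n) else 0)" for n m
    using integrable_monomial_product[of n m] integral_monomial_product[of n m]
    by (simp add: has_bochner_integral_iff)
  have "has_bochner_integral lborel (\<lambda>z. complex_of_real ((cmod (\<Sum>n\<in>A. a n * z ^ n))\<^sup>2 * v z))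
      (\<Sum>n\<in>A. \<Sum>m\<in>A. a n * cnj (a m) * (if n = m then of_real (moment n) else 0))"
    unfolding expand
    by (intro has_bochner_integral_sum has_bochner_integral_mult_right term_integral)
  also have "(\<Sum>n\<in>A. \<Sum>m\<in>A. a n * cnj (a m) * (if n = m then of_real (moment n) else 0))
      = (\<Sum>n\<in>A. a n * cnj (a n) * of_real (moment n))"
    using assms by (intro sum.cong refl) (simp add: if_distrib[of "\<lambda>x. _ * x"] cong: if_cong)
  also have "\<dots> = complex_of_real (\<Sum>n\<in>A. (cmod (a n))\<^sup>2 * moment n)"
    by (simp add: complex_norm_square del: of_real_power)
  finally show ?thesis
    by (simp only: has_bochner_integral_iff complex_of_real_integrable_eq integral_complex_of_real of_real_eq_iff)
qed

end

definition taylor_section :: "(complex \<Rightarrow> complex) \<Rightarrow> nat \<Rightarrow> complex \<Rightarrow> complex" where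
  "taylor_section f N z = (\<Sum>n<N. (deriv ^^ n) f 0 / fact n * z ^ n)"

lemma taylor_section_tendsto:
  assumes "f holomorphic_on UNIV"
  shows "(\<lambda>N. taylor_section f N z) \<longlonglongrightarrow> f z"
proof -
  have "(\<lambda>n. (deriv ^^ n) f 0 / fact n * (z - 0) ^ n) sums f z"
    using assms by (intro holomorphic_power_series[where r = "cmod z + 1"])
      (auto intro: holomorphic_on_subset)
  then show ?thesis
    by (simp add: sums_def taylor_section_def)
qed

text \<open>
  The absolutely convergent Taylor series at radius \<open>|R|\<close> bounds all sections on the disc; this is
  the dominating constant for the passage to the limit under the integral.
\<close>

lemma taylor_section_bounded:
  assumes "f holomorphic_on UNIV"
  obtains B where "\<And>N z. cmod z \<le> R \<Longrightarrow> cmod (taylor_section f N z) \<le> B"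
proof -
  define a where "a n = (deriv ^^ n) f 0 / fact n" for n
  define r where "r = \<bar>R\<bar>"
  have "(\<lambda>n. a n * (of_real (r + 1) - 0) ^ n) sums f (of_real (r + 1))"
    unfolding a_def using assms
    by (intro holomorphic_power_series[where r = "r + 2"])
       (auto intro: holomorphic_on_subset simp: r_def)
  then have "summable (\<lambda>n. cmod (a n * of_real r ^ n))"
    by (intro powser_insidea[where x = "of_real (r + 1)"]) (auto simp: sums_iff r_def)
  then have sm: "summable (\<lambda>n. cmod (a n) * r ^ n)"
    by (simp add: norm_mult norm_power r_def)
  have "cmod (taylor_section f N z) \<le> (\<Sum>n. cmod (a n) * r ^ n)" if "cmod z \<le> R" for N z
  proof -
    have "cmod (taylor_section f N z) \<le> (\<Sum>n<N. cmod (a n * z ^ n))"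
      unfolding taylor_section_def a_def by (rule norm_sum)
    also have "\<dots> \<le> (\<Sum>n<N. cmod (a n) * r ^ n)"
      using that by (intro sum_mono) (auto simp: norm_mult norm_power r_def intro!: mult_left_mono power_mono)
    also have "\<dots> \<le> (\<Sum>n. cmod (a n) * r ^ n)"
      using sm by (intro sum_le_suminf) (auto simp: r_def)
    finally show ?thesis .
  qed
  then show ?thesis ..
qed

lemma borel_measurable_entire:
  fixes f :: "complex \<Rightarrow> complex"
  shows "f holomorphic_on UNIV \<Longrightarrow> f \<in> borel_measurable borel"
  by (intro borel_measurable_continuous_onI holomorphic_on_imp_continuous_on)

lemma borel_measurable_taylor_section [measurable]: "taylor_section f N \<in> borel_measurable borel"
  unfolding taylor_section_def by measurable

context radial_weight
begin

lemma truncate: "radial_weight (\<lambda>z. indicator (cball 0 R) z * v z)"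
proof
  show "(\<lambda>z. indicator (cball 0 R) z * v z) \<in> borel_measurable borel"
    by (intro borel_measurable_times borel_measurable_indicator measurable_weight) auto
  show "0 \<le> indicator (cball 0 R) z * v z" for z
    by (simp add: weight_nonneg)
  show "indicator (cball 0 R) z * v z = indicator (cball 0 R) z' * v z'" if "cmod z = cmod z'" for z z'
    using that radial[OF that] by (simp add: indicator_def)
  show "integrable lborel (\<lambda>z. cmod z ^ k * (indicator (cball 0 R) z * v z))" for k
    using integrable_mult_indicator[OF _ integrable_moment[of k], of "cball 0 R"]
    by (simp add: mult_ac)
qed

text \<open>
  On a bounded support the Taylor sections are uniformly bounded, so their norms, which increase
  by Parseval's identity, converge to the norm of \<open>f\<close>.
\<close>

lemma bessel_compact_support:
  assumes f: "f holomorphic_on UNIV" and supp: "\<And>z. cmod z > R \<Longrightarrow> v z = 0"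
  shows "(\<Sum>n<N. (cmod ((deriv ^^ n) f 0 / fact n))\<^sup>2 * moment n) \<le> (LINT z|lborel. (cmod (f z))\<^sup>2 * v z)"
    (is "?S N \<le> ?I")
proof -
  note [measurable] = borel_measurable_entire[OF f]
  obtain B where B: "\<And>N z. cmod z \<le> R \<Longrightarrow> cmod (taylor_section f N z) \<le> B"
    using taylor_section_bounded[OF f] by blast
  have "(\<lambda>K. LINT z|lborel. (cmod (taylor_section f K z))\<^sup>2 * v z) \<longlonglongrightarrow> ?I"
  proof (rule integral_dominated_convergence)
    show "integrable lborel (\<lambda>z. B\<^sup>2 * v z)"
      using integrable_moment[of 0] by simp
    show "AE z in lborel. (\<lambda>K. (cmod (taylor_section f K z))\<^sup>2 * v z) \<longlonglongrightarrow> (cmod (f z))\<^sup>2 * v z"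
      by (intro AE_I2 tendsto_intros taylor_section_tendsto f)
    have "(cmod (taylor_section f K z))\<^sup>2 * v z \<le> B\<^sup>2 * v z" for K z
      using B[of z K] supp[of z] weight_nonneg[of z]
      by (cases "cmod z \<le> R") (auto intro!: mult_right_mono power_mono)
    then show "AE z in lborel. norm ((cmod (taylor_section f K z))\<^sup>2 * v z) \<le> B\<^sup>2 * v z" for K
      by (simp add: weight_nonneg)
  qed auto
  then have lim: "?S \<longlonglongrightarrow> ?I"
    unfolding taylor_section_def
    by (simp only: has_bochner_integral_integral_eq[OF has_bochner_integral_polynomial[OF finite_lessThan]])
  have "incseq ?S"
    by (intro incseq_SucI) (simp add: moment_nonneg)
  then show ?thesis
    using lim by (rule incseq_le)
qed

text \<open>
  Cutting the weight off at radius \<open>k\<close> keeps it radial and only decreases the norm of \<open>f\<close>, while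
  the norm of a fixed Taylor section converges to its full value as \<open>k\<close> grows.
\<close>

lemma bessel:
  assumes f: "f holomorphic_on UNIV" and int: "integrable lborel (\<lambda>z. (cmod (f z))\<^sup>2 * v z)"
  shows "(\<Sum>n<N. (cmod ((deriv ^^ n) f 0 / fact n))\<^sup>2 * moment n) \<le> (LINT z|lborel. (cmod (f z))\<^sup>2 * v z)"
    (is "?S \<le> ?I")
proof -
  note [measurable] = borel_measurable_entire[OF f]
  define v' where "v' k z = indicator (cball 0 (real k)) z * v z" for k z
  have v'_meas [measurable]: "v' k \<in> borel_measurable borel" for k
    unfolding v'_def by (intro borel_measurable_times borel_measurable_indicator measurable_weight) auto
  have v'_le: "v' k z \<le> v z" and v'_nonneg: "0 \<le> v' k z" for k z
    using weight_nonneg[of z] by (auto simp: v'_def indicator_def)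
  have section_int: "has_bochner_integral lborel (\<lambda>z. (cmod (taylor_section f N z))\<^sup>2 * v z) ?S"
    unfolding taylor_section_def by (rule has_bochner_integral_polynomial) simp
  have "(\<lambda>k. LINT z|lborel. (cmod (taylor_section f N z))\<^sup>2 * v' k z)
      \<longlonglongrightarrow> (LINT z|lborel. (cmod (taylor_section f N z))\<^sup>2 * v z)"
  proof (rule integral_dominated_convergence)
    show "integrable lborel (\<lambda>z. (cmod (taylor_section f N z))\<^sup>2 * v z)"
      using section_int by (simp add: has_bochner_integral_iff)
    have "(\<lambda>k. v' k z) \<longlonglongrightarrow> v z" for z
    proof (rule tendsto_eventually)
      show "\<forall>\<^sub>F k in sequentially. v' k z = v z"
        using eventually_ge_at_top[of "nat \<lceil>cmod z\<rceil>"]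
        by eventually_elim (auto simp: v'_def indicator_def)
    qed
    then show "AE z in lborel. (\<lambda>k. (cmod (taylor_section f N z))\<^sup>2 * v' k z)
        \<longlonglongrightarrow> (cmod (taylor_section f N z))\<^sup>2 * v z"
      by (intro AE_I2 tendsto_intros)
    show "AE z in lborel. norm ((cmod (taylor_section f N z))\<^sup>2 * v' k z)
        \<le> (cmod (taylor_section f N z))\<^sup>2 * v z" for k
      using v'_le v'_nonneg by (auto simp: abs_mult intro!: mult_left_mono)
  qed auto
  then have lim: "(\<lambda>k. LINT z|lborel. (cmod (taylor_section f N z))\<^sup>2 * v' k z) \<longlonglongrightarrow> ?S"
    using has_bochner_integral_integral_eq[OF section_int] by simp
  have "(LINT z|lborel. (cmod (taylor_section f N z))\<^sup>2 * v' k z) \<le> ?I" for k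
  proof -
    interpret k: radial_weight "v' k"
      unfolding v'_def by (rule truncate)
    have "(LINT z|lborel. (cmod (taylor_section f N z))\<^sup>2 * v' k z)
        = (\<Sum>n<N. (cmod ((deriv ^^ n) f 0 / fact n))\<^sup>2 * k.moment n)"
      unfolding taylor_section_def
      by (rule has_bochner_integral_integral_eq[OF k.has_bochner_integral_polynomial]) simp
    also have "\<dots> \<le> (LINT z|lborel. (cmod (f z))\<^sup>2 * v' k z)"
      by (rule k.bessel_compact_support[OF f, of "real k"]) (simp add: v'_def)
    also have "\<dots> \<le> ?I"
      using int v'_le v'_nonneg by (intro integral_mono_AE') (auto simp: weight_nonneg intro!: mult_left_mono)
    finally show ?thesis .
  qed
  then show ?thesis
    using lim by (intro LIMSEQ_le_const2) auto
qed

text \<open>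
  By Bessel's inequality the coefficient series converges, so the sections form a Cauchy sequence.
  They converge pointwise to \<open>f\<close>, hence Fatou's lemma turns the Cauchy estimate into an estimate for
  the distance from \<open>f\<close> to a section.
\<close>

lemma taylor_sections_dense:
  assumes f: "f holomorphic_on UNIV" and int: "integrable lborel (\<lambda>z. (cmod (f z))\<^sup>2 * v z)"
    and "\<epsilon> > 0"
  obtains N where "(LINT z|lborel. (cmod (f z - taylor_section f N z))\<^sup>2 * v z) \<le> \<epsilon>"
proof -
  note [measurable] = borel_measurable_entire[OF f]
  define a where "a n = (deriv ^^ n) f 0 / fact n" for n
  have "summable (\<lambda>n. (cmod (a n))\<^sup>2 * moment n)"
    unfolding a_def
    by (rule summableI_nonneg_bounded[OF _ bessel[OF f int]]) (simp add: moment_nonneg)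
  then obtain N where N: "\<And>M. norm (\<Sum>n\<in>{N..<M}. (cmod (a n))\<^sup>2 * moment n) < \<epsilon>"
    using \<open>\<epsilon> > 0\<close> unfolding summable_Cauchy by blast
  define u where "u M z = ennreal ((cmod (taylor_section f M z - taylor_section f N z))\<^sup>2 * v z)" for M z
  have u_bound: "(\<integral>\<^sup>+ z. u M z \<partial>lborel) \<le> ennreal \<epsilon>" if "M \<ge> N" for M
  proof -
    have "taylor_section f M z - taylor_section f N z = (\<Sum>n\<in>{N..<M}. a n * z ^ n)" for z
      unfolding taylor_section_def a_def lessThan_atLeast0
      using sum_diff_nat_ivl[of 0 N M "\<lambda>n. (deriv ^^ n) f 0 / fact n * z ^ n"] that by simp
    then have "(\<integral>\<^sup>+ z. u M z \<partial>lborel) = ennreal (\<Sum>n\<in>{N..<M}. (cmod (a n))\<^sup>2 * moment n)"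
      using has_bochner_integral_polynomial[of "{N..<M}" a]
      by (simp add: u_def nn_integral_eq_integral weight_nonneg has_bochner_integral_iff)
    also have "\<dots> \<le> ennreal \<epsilon>"
      using N[of M] by (intro ennreal_leI) simp
    finally show ?thesis .
  qed
  have "(\<lambda>M. u M z) \<longlonglongrightarrow> ennreal ((cmod (f z - taylor_section f N z))\<^sup>2 * v z)" for z
    unfolding u_def by (intro tendsto_intros taylor_section_tendsto f)
  then have "(\<integral>\<^sup>+ z. ennreal ((cmod (f z - taylor_section f N z))\<^sup>2 * v z) \<partial>lborel)
      = (\<integral>\<^sup>+ z. liminf (\<lambda>M. u M z) \<partial>lborel)"
    by (intro nn_integral_cong lim_imp_Liminf[symmetric]) auto
  also have "\<dots> \<le> liminf (\<lambda>M. \<integral>\<^sup>+ z. u M z \<partial>lborel)"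
    by (rule nn_integral_liminf) (simp add: u_def)
  also have "\<dots> \<le> limsup (\<lambda>M. \<integral>\<^sup>+ z. u M z \<partial>lborel)"
    by (rule Liminf_le_Limsup) simp
  also have "\<dots> \<le> ennreal \<epsilon>"
    using u_bound by (intro Limsup_bounded) (auto simp: eventually_at_top_linorder)
  finally have "(\<integral>\<^sup>+ z. ennreal ((cmod (f z - taylor_section f N z))\<^sup>2 * v z) \<partial>lborel) \<le> ennreal \<epsilon>" .
  then have "(LINT z|lborel. (cmod (f z - taylor_section f N z))\<^sup>2 * v z) \<le> \<epsilon>"
    using \<open>\<epsilon> > 0\<close> by (subst integral_eq_nn_integral) (auto simp: weight_nonneg enn2real_leI)
  then show ?thesis ..
qed

end

section \<open>Polynomials and derivative functionals on the Fock space\<close>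

lemma fock_space_holomorphic: "f \<in> fock_space \<alpha> \<Longrightarrow> f holomorphic_on UNIV"
  by (simp add: fock_space_def)

lemma fock_space_integrable:
  "f \<in> fock_space \<alpha> \<Longrightarrow> integrable lborel (\<lambda>z. (cmod (f z))\<^sup>2 * exp (- \<alpha> * (cmod z)\<^sup>2))"
  by (simp add: fock_space_def)

lemma fock_space_cmult:
  assumes "f \<in> fock_space \<alpha>"
  shows "(\<lambda>z. c * f z) \<in> fock_space \<alpha>"
  using fock_space_holomorphic[OF assms] integrable_mult_right[OF fock_space_integrable[OF assms], of "(cmod c)\<^sup>2"]
  by (auto simp: fock_space_def norm_mult power_mult_distrib mult_ac intro!: holomorphic_intros)

lemma fock_space_add:
  assumes "f \<in> fock_space \<alpha>" "g \<in> fock_space \<alpha>"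
  shows "(\<lambda>z. f z + g z) \<in> fock_space \<alpha>"
proof -
  note hol = fock_space_holomorphic[OF assms(1)] fock_space_holomorphic[OF assms(2)]
  note [measurable] = hol[THEN borel_measurable_entire]
  define G where "G z = exp (- \<alpha> * (cmod z)\<^sup>2)" for z
  have [measurable]: "G \<in> borel_measurable borel" and "G z > 0" for z
    unfolding G_def by auto
  have "integrable lborel (\<lambda>z. (cmod (f z + g z))\<^sup>2 * G z)"
  proof (rule Bochner_Integration.integrable_bound)
    show "integrable lborel (\<lambda>z. 2 * ((cmod (f z))\<^sup>2 * G z) + 2 * ((cmod (g z))\<^sup>2 * G z))"
      using assms[THEN fock_space_integrable] by (simp add: G_def)
    have "(cmod (f z + g z))\<^sup>2 \<le> 2 * (cmod (f z))\<^sup>2 + 2 * (cmod (g z))\<^sup>2" for z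
    proof -
      have "(cmod (f z + g z))\<^sup>2 \<le> (cmod (f z) + cmod (g z))\<^sup>2"
        by (intro power_mono norm_triangle_ineq) simp
      also have "\<dots> \<le> 2 * (cmod (f z))\<^sup>2 + 2 * (cmod (g z))\<^sup>2"
        using zero_le_power2[of "cmod (f z) - cmod (g z)"] by (simp add: power2_sum power2_diff)
      finally show ?thesis .
    qed
    then have "(cmod (f z + g z))\<^sup>2 * G z \<le> (2 * (cmod (f z))\<^sup>2 + 2 * (cmod (g z))\<^sup>2) * G z" for z
      using \<open>G z > 0\<close> by (intro mult_right_mono) (auto simp: less_imp_le)
    then show "AE z in lborel. norm ((cmod (f z + g z))\<^sup>2 * G z)
        \<le> norm (2 * ((cmod (f z))\<^sup>2 * G z) + 2 * ((cmod (g z))\<^sup>2 * G z))"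
      using \<open>\<And>z. G z > 0\<close> by (auto simp: algebra_simps less_imp_le abs_mult intro!: AE_I2)
  qed measurable
  then show ?thesis
    using hol by (auto simp: fock_space_def G_def intro!: holomorphic_intros)
qed

lemma fock_norm_nonneg: "\<alpha> > 0 \<Longrightarrow> fock_norm \<alpha> f \<ge> 0"
  unfolding fock_norm_def by (auto intro!: integral_nonneg_AE mult_nonneg_nonneg)

lemma fock_norm_cmult: "fock_norm \<alpha> (\<lambda>z. c * f z) = cmod c * fock_norm \<alpha> f"
proof -
  have "(LINT z|lborel. (cmod (c * f z))\<^sup>2 * exp (- \<alpha> * (cmod z)\<^sup>2))
      = (cmod c)\<^sup>2 * (LINT z|lborel. (cmod (f z))\<^sup>2 * exp (- \<alpha> * (cmod z)\<^sup>2))"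
    by (subst integral_mult_right_zero[symmetric]) (simp add: norm_mult power_mult_distrib mult_ac)
  then show ?thesis
    unfolding fock_norm_def
    by (simp only: mult.left_commute[of _ "(cmod c)\<^sup>2"] real_sqrt_mult[of "(cmod c)\<^sup>2"]) simp
qed

lemma integral_eq_fock_norm:
  assumes "\<alpha> > 0"
  shows "(LINT z|lborel. (cmod (f z))\<^sup>2 * exp (- \<alpha> * (cmod z)\<^sup>2)) = pi / \<alpha> * (fock_norm \<alpha> f)\<^sup>2"
proof -
  have "(LINT z|lborel. (cmod (f z))\<^sup>2 * exp (- \<alpha> * (cmod z)\<^sup>2)) \<ge> 0"
    by (intro integral_nonneg_AE) auto
  then show ?thesis
    using assms by (simp add: fock_norm_def)
qed

lemma integrable_complex_gaussian:
  assumes "\<alpha> > 0"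
  shows "integrable lborel (\<lambda>z::complex. exp (- \<alpha> * (cmod z)\<^sup>2))"
proof -
  define \<sigma> where "\<sigma> = sqrt (1 / (2 * \<alpha>))"
  have \<sigma>: "\<sigma> > 0" "2 * \<sigma>\<^sup>2 = 1 / \<alpha>"
    using assms by (auto simp: \<sigma>_def)
  have "exp (- \<alpha> * x\<^sup>2) = sqrt (2 * pi * \<sigma>\<^sup>2) * normal_density 0 \<sigma> x" for x
    using \<sigma> assms by (simp add: normal_density_def)
  then have "integrable lborel (\<lambda>x::real. exp (- \<alpha> * x\<^sup>2))"
    using \<sigma> by simp
  then have fin: "(\<integral>\<^sup>+ (x::real). ennreal (exp (- \<alpha> * x\<^sup>2)) \<partial>lborel) < \<infinity>"
    by (simp add: integrable_iff_bounded)
  have "(\<integral>\<^sup>+ (z::complex). ennreal (exp (- \<alpha> * (cmod z)\<^sup>2)) \<partial>lborel)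
      = (\<integral>\<^sup>+ (z::complex). (\<Prod>b\<in>Basis. ennreal (exp (- \<alpha> * (z \<bullet> b)\<^sup>2))) \<partial>lborel)"
    by (intro nn_integral_cong)
       (simp add: Basis_complex_def cmod_power2 ennreal_mult[symmetric] exp_add[symmetric] algebra_simps)
  also have "\<dots> = (\<Prod>b\<in>(Basis::complex set). \<integral>\<^sup>+ x. ennreal (exp (- \<alpha> * x\<^sup>2)) \<partial>lborel)"
    by (rule nn_integral_lborel_prod) auto
  also have "\<dots> < \<infinity>"
    using fin by (simp add: Basis_complex_def ennreal_mult_less_top)
  finally show ?thesis
    by (simp add: integrable_iff_bounded)
qed

lemma power_le_fact_mult_exp:
  fixes x :: real
  assumes "x \<ge> 0"
  shows "x ^ k \<le> fact k * exp x"
proof -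
  have "(\<Sum>i\<in>{k}. x ^ i /\<^sub>R fact i) \<le> (\<Sum>i. x ^ i /\<^sub>R fact i)"
    using assms by (intro sum_le_suminf summable_exp_generic) auto
  then show ?thesis
    by (simp add: exp_def divide_inverse_commute[symmetric] field_simps)
qed

text \<open>
  Moments are dominated by a wider Gaussian: \<open>t ^ (2 * k)\<close> is at most a constant times
  \<open>exp (\<alpha> / 2 * t\<^sup>2)\<close>, and \<open>t ^ k \<le> 1 + t ^ (2 * k)\<close> reduces to these exponents.
\<close>

lemma radial_weight_gaussian:
  assumes "\<alpha> > 0"
  shows "radial_weight (\<lambda>z. exp (- \<alpha> * (cmod z)\<^sup>2))"
proof
  fix k
  show "integrable lborel (\<lambda>z::complex. cmod z ^ k * exp (- \<alpha> * (cmod z)\<^sup>2))"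
  proof (rule Bochner_Integration.integrable_bound)
    let ?C = "fact k * (2 / \<alpha>) ^ k"
    show "integrable lborel (\<lambda>z::complex. exp (- \<alpha> * (cmod z)\<^sup>2) + ?C * exp (- (\<alpha> / 2) * (cmod z)\<^sup>2))"
      using assms
      by (intro Bochner_Integration.integrable_add integrable_mult_right integrable_complex_gaussian) auto
    have "t ^ k * exp (- \<alpha> * t\<^sup>2) \<le> exp (- \<alpha> * t\<^sup>2) + ?C * exp (- (\<alpha> / 2) * t\<^sup>2)"
      if "t \<ge> 0" for t
    proof -
      have "t ^ k \<le> 1 + t ^ (2 * k)"
        using that power_increasing[of k "2 * k" t] power_le_one[of t k] zero_le_power[of t "2 * k"]
        by (cases "t \<le> 1") (auto simp: add_increasing add_increasing2)
      then have "t ^ k * exp (- \<alpha> * t\<^sup>2) \<le> exp (- \<alpha> * t\<^sup>2) + t ^ (2 * k) * exp (- \<alpha> * t\<^sup>2)"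
        using mult_right_mono[of "t ^ k" "1 + t ^ (2 * k)" "exp (- \<alpha> * t\<^sup>2)"] by (simp add: algebra_simps)
      moreover have "t ^ (2 * k) * exp (- \<alpha> * t\<^sup>2) \<le> ?C * exp (- (\<alpha> / 2) * t\<^sup>2)"
      proof -
        have "t ^ (2 * k) = (2 / \<alpha>) ^ k * (\<alpha> / 2 * t\<^sup>2) ^ k"
          unfolding power_mult_distrib[symmetric] power_mult using assms by simp
        also have "\<dots> \<le> (2 / \<alpha>) ^ k * (fact k * exp (\<alpha> / 2 * t\<^sup>2))"
          using assms power_le_fact_mult_exp[of "\<alpha> / 2 * t\<^sup>2" k]
          by (intro mult_left_mono) auto
        also have "\<dots> = ?C * exp (\<alpha> / 2 * t\<^sup>2)"
          by (simp only: mult_ac)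
        finally have "t ^ (2 * k) \<le> ?C * exp (\<alpha> / 2 * t\<^sup>2)" .
        then have "t ^ (2 * k) * exp (- \<alpha> * t\<^sup>2) \<le> ?C * exp (\<alpha> / 2 * t\<^sup>2) * exp (- \<alpha> * t\<^sup>2)"
          by (intro mult_right_mono) auto
        also have "\<dots> = ?C * exp (- (\<alpha> / 2) * t\<^sup>2)"
          by (simp add: mult.assoc exp_add[symmetric] del: mult_cancel_left)
        finally show ?thesis .
      qed
      ultimately show ?thesis by linarith
    qed
    from this[OF norm_ge_zero] have
      "cmod z ^ k * exp (- \<alpha> * (cmod z)\<^sup>2) \<le> exp (- \<alpha> * (cmod z)\<^sup>2) + ?C * exp (- (\<alpha> / 2) * (cmod z)\<^sup>2)" for z .
    then show "AE z in lborel. norm (cmod z ^ k * exp (- \<alpha> * (cmod z)\<^sup>2))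
        \<le> norm (exp (- \<alpha> * (cmod z)\<^sup>2) + ?C * exp (- (\<alpha> / 2) * (cmod z)\<^sup>2))"
      using assms by (intro AE_I2) (auto simp: abs_mult intro: order_trans)
  qed simp
qed auto

lemma polynomial_in_fock_space:
  assumes "\<alpha> > 0"
  shows "poly P \<in> fock_space \<alpha>"
proof -
  interpret radial_weight "\<lambda>z. exp (- \<alpha> * (cmod z)\<^sup>2)"
    using assms by (rule radial_weight_gaussian)
  have "has_bochner_integral lborel (\<lambda>z. (cmod (\<Sum>n\<in>{..degree P}. coeff P n * z ^ n))\<^sup>2 * exp (- \<alpha> * (cmod z)\<^sup>2))
     (\<Sum>n\<in>{..degree P}. (cmod (coeff P n))\<^sup>2 * moment n)"
    by (rule has_bochner_integral_polynomial) simp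
  then show ?thesis
    by (auto simp: fock_space_def poly_altdef has_bochner_integral_iff intro!: holomorphic_intros)
qed

lemma polynomials_dense_in_fock_space:
  assumes "\<alpha> > 0" "f \<in> fock_space \<alpha>" "\<epsilon> > 0"
  obtains P where "fock_norm \<alpha> (\<lambda>z. f z - poly P z) \<le> \<epsilon>"
proof -
  interpret radial_weight "\<lambda>z. exp (- \<alpha> * (cmod z)\<^sup>2)"
    using assms(1) by (rule radial_weight_gaussian)
  have "pi / \<alpha> * \<epsilon>\<^sup>2 > 0"
    using assms by simp
  then obtain N where N: "(LINT z|lborel. (cmod (f z - taylor_section f N z))\<^sup>2 * exp (- \<alpha> * (cmod z)\<^sup>2))
      \<le> pi / \<alpha> * \<epsilon>\<^sup>2"
    by (rule taylor_sections_dense[OF fock_space_holomorphic[OF assms(2)] fock_space_integrable[OF assms(2)]])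
  define P where "P = (\<Sum>n<N. monom ((deriv ^^ n) f 0 / fact n) n)"
  have "taylor_section f N z = poly P z" for z
    by (simp add: taylor_section_def P_def poly_sum poly_monom)
  with N have "pi / \<alpha> * (fock_norm \<alpha> (\<lambda>z. f z - poly P z))\<^sup>2 \<le> pi / \<alpha> * \<epsilon>\<^sup>2"
    by (simp only: integral_eq_fock_norm[OF assms(1), symmetric])
  then have "(fock_norm \<alpha> (\<lambda>z. f z - poly P z))\<^sup>2 \<le> \<epsilon>\<^sup>2"
    using assms(1) by (simp add: mult_le_cancel_left divide_simps)
  then have "fock_norm \<alpha> (\<lambda>z. f z - poly P z) \<le> \<epsilon>"
    by (rule power2_le_imp_le) (use assms(3) in simp)
  then show ?thesis ..
qed

lemma radial_weight_disc: "radial_weight (indicator (cball 0 R))"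
proof
  fix k
  show "integrable lborel (\<lambda>z::complex. cmod z ^ k * indicator (cball 0 R) z)"
    using borel_integrable_compact[of "cball 0 R" "\<lambda>z::complex. cmod z ^ k"]
    by (simp add: mult_ac continuous_intros)
  show "indicator (cball 0 R) \<in> borel_measurable (borel :: complex measure)"
    by (intro borel_measurable_indicator) auto
qed (auto simp: indicator_def)

text \<open>
  The disc with center \<open>3/4\<close> and radius \<open>1/4\<close> has positive area and lies in the unit disc, away
  from the origin, the only point of the unit disc where the integrand can vanish.
\<close>

lemma disc_moment_pos: "(LINT z|lborel. cmod z ^ (2 * n) * indicator (cball 0 1) z) > 0"
proof -
  interpret radial_weight "indicator (cball 0 1)"
    by (rule radial_weight_disc)
  let ?B = "cball (3 / 4 :: complex) (1 / 4)"
  have sub: "1 / 2 \<le> cmod z \<and> cmod z \<le> 1" if "z \<in> ?B" for z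
    using that norm_triangle_ineq2[of "3 / 4" z] norm_triangle_ineq2[of z "3 / 4"]
    by (auto simp: dist_norm norm_minus_commute)
  have "0 < (1 / 2) ^ (2 * n) * measure lborel ?B"
    by (simp add: content_cball_pos)
  also have "\<dots> = (LINT z|lborel. (1 / 2) ^ (2 * n) * indicator ?B z)"
    by simp
  also have "\<dots> \<le> (LINT z|lborel. cmod z ^ (2 * n) * indicator (cball 0 1) z)"
  proof (rule integral_mono)
    show "integrable lborel (\<lambda>z. (1 / 2) ^ (2 * n) * indicator ?B z :: real)"
      by (intro integrable_mult_right integrable_real_indicator) (use emeasure_lborel_cball_finite in auto)
    show "(1 / 2) ^ (2 * n) * indicator ?B z \<le> cmod z ^ (2 * n) * indicator (cball 0 1) z" for z
      using sub[of z] power_mono[of "1 / 2" "cmod z" "2 * n"] by (auto simp: indicator_def)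
  qed (rule integrable_moment)
  finally show ?thesis .
qed

text \<open>
  Bessel's inequality for the translate \<open>z \<mapsto> f (p + z)\<close> over the unit disc bounds the derivative
  by the unweighted \<open>L\<^sup>2\<close> norm of \<open>f\<close> over the disc around \<open>p\<close>, where the Gaussian is bounded below
  by \<open>1 / E\<close>.
\<close>

lemma higher_deriv_functional_bounded:
  fixes p :: complex
  assumes "\<alpha> > 0"
  obtains C where "C \<ge> 0" "\<And>f. f \<in> fock_space \<alpha> \<Longrightarrow> cmod ((deriv ^^ n) f p) \<le> C * fock_norm \<alpha> f"
proof -
  interpret disc: radial_weight "indicator (cball 0 1)"
    by (rule radial_weight_disc)
  have m: "disc.moment n > 0"
    using disc_moment_pos by (simp add: disc.moment_def)
  define E where "E = exp (\<alpha> * (cmod p + 1)\<^sup>2)"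
  define D where "D = (fact n)\<^sup>2 / disc.moment n * (E * (pi / \<alpha>))"
  have "D \<ge> 0"
    using m assms by (simp add: D_def E_def)
  have "(cmod ((deriv ^^ n) f p))\<^sup>2 \<le> D * (fock_norm \<alpha> f)\<^sup>2" if f: "f \<in> fock_space \<alpha>" for f
  proof -
    note hol = fock_space_holomorphic[OF f]
    note [measurable] = borel_measurable_entire[OF hol]
    define g where "g z = f (p + z)" for z
    have g: "g holomorphic_on UNIV"
      unfolding g_def using holomorphic_on_compose[of "\<lambda>z. p + z" UNIV f] hol
      by (simp add: o_def holomorphic_on_add holomorphic_on_const holomorphic_on_ident)
    have deriv_g: "(deriv ^^ n) g 0 = (deriv ^^ n) f p"
      using higher_deriv_compose_linear'[OF hol open_UNIV open_UNIV, of 0 1 p n]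
      by (simp add: g_def[abs_def] add.commute)
    have dominated: "(cmod (g z))\<^sup>2 * indicator (cball 0 1) z
        \<le> E * ((cmod (f (p + z)))\<^sup>2 * exp (- \<alpha> * (cmod (p + z))\<^sup>2))" for z
    proof (cases "z \<in> cball 0 1")
      case True
      then have "cmod (p + z) \<le> cmod p + 1"
        using norm_triangle_ineq[of p z] by simp
      then have "\<alpha> * (cmod (p + z))\<^sup>2 \<le> \<alpha> * (cmod p + 1)\<^sup>2"
        using assms by (intro mult_left_mono power_mono) auto
      then have "1 \<le> E * exp (- \<alpha> * (cmod (p + z))\<^sup>2)"
        by (simp add: E_def exp_add[symmetric])
      then show ?thesis
        using True mult_left_mono[of 1 "E * exp (- \<alpha> * (cmod (p + z))\<^sup>2)" "(cmod (g z))\<^sup>2"]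
        by (simp add: g_def mult_ac)
    qed (simp add: E_def)
    have shifted: "integrable lborel (\<lambda>z. (cmod (f (p + z)))\<^sup>2 * exp (- \<alpha> * (cmod (p + z))\<^sup>2))"
      and shift: "(LINT z|lborel. (cmod (f (p + z)))\<^sup>2 * exp (- \<alpha> * (cmod (p + z))\<^sup>2))
        = (LINT z|lborel. (cmod (f z))\<^sup>2 * exp (- \<alpha> * (cmod z)\<^sup>2))"
      using fock_space_integrable[OF f]
        integrable_distr_eq[of "(+) p" lborel borel "\<lambda>z. (cmod (f z))\<^sup>2 * exp (- \<alpha> * (cmod z)\<^sup>2)"]
        integral_distr[of "(+) p" lborel borel "\<lambda>z. (cmod (f z))\<^sup>2 * exp (- \<alpha> * (cmod z)\<^sup>2)"]
      by (simp_all add: lborel_distr_plus)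
    have g_int: "integrable lborel (\<lambda>z. (cmod (g z))\<^sup>2 * indicator (cball 0 1) z)"
    proof (rule Bochner_Integration.integrable_bound)
      show "integrable lborel (\<lambda>z. E * ((cmod (f (p + z)))\<^sup>2 * exp (- \<alpha> * (cmod (p + z))\<^sup>2)))"
        using shifted by simp
      show "(\<lambda>z. (cmod (g z))\<^sup>2 * indicator (cball 0 1) z) \<in> borel_measurable lborel"
        using borel_measurable_entire[OF g] by measurable
      show "AE z in lborel. norm ((cmod (g z))\<^sup>2 * indicator (cball 0 1) z)
          \<le> norm (E * ((cmod (f (p + z)))\<^sup>2 * exp (- \<alpha> * (cmod (p + z))\<^sup>2)))"
        using dominated by (intro AE_I2) (auto simp: abs_mult E_def)
    qed
    have "(cmod ((deriv ^^ n) f p / fact n))\<^sup>2 * disc.moment n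
        \<le> (\<Sum>k<Suc n. (cmod ((deriv ^^ k) g 0 / fact k))\<^sup>2 * disc.moment k)"
      using disc.moment_nonneg by (simp add: deriv_g sum_nonneg)
    also have "\<dots> \<le> (LINT z|lborel. (cmod (g z))\<^sup>2 * indicator (cball 0 1) z)"
      by (rule disc.bessel[OF g g_int])
    also have "\<dots> \<le> (LINT z|lborel. E * ((cmod (f (p + z)))\<^sup>2 * exp (- \<alpha> * (cmod (p + z))\<^sup>2)))"
      using g_int shifted dominated by (intro integral_mono) auto
    also have "\<dots> = E * (pi / \<alpha> * (fock_norm \<alpha> f)\<^sup>2)"
      using assms by (simp only: integral_mult_right_zero shift integral_eq_fock_norm[OF assms])
    finally show ?thesis
      using m assms by (simp add: D_def norm_divide power_divide field_simps)
  qed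
  note bound = this
  have "cmod ((deriv ^^ n) f p) \<le> sqrt D * fock_norm \<alpha> f" if "f \<in> fock_space \<alpha>" for f
    by (rule power2_le_imp_le)
       (use bound that \<open>D \<ge> 0\<close> fock_norm_nonneg[OF assms, of f] in \<open>auto simp: power_mult_distrib\<close>)
  then show ?thesis
    using \<open>D \<ge> 0\<close> by (intro that[of "sqrt D"]) auto
qed

section \<open>Extended eigenvalues of the composition operator\<close>

lemma
  assumes "bounded_operator_on H N X"
  shows bounded_operator_on_closed: "f \<in> H \<Longrightarrow> X f \<in> H"
    and bounded_operator_on_add: "f \<in> H \<Longrightarrow> g \<in> H \<Longrightarrow> X (\<lambda>x. f x + g x) = (\<lambda>x. X f x + X g x)"
    and bounded_operator_on_cmult: "f \<in> H \<Longrightarrow> X (\<lambda>x. c * f x) = (\<lambda>x. c * X f x)"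
  using assms by (simp_all add: bounded_operator_on_def)

lemma bounded_operator_on_diff_of_kernel:
  assumes X: "bounded_operator_on (fock_space \<alpha>) (fock_norm \<alpha>) X"
    and f: "f \<in> fock_space \<alpha>" and g: "g \<in> fock_space \<alpha>" "X g = (\<lambda>z. 0)"
  shows "X (\<lambda>z. f z - g z) = X f"
proof -
  have ng: "(\<lambda>z. - 1 * g z) \<in> fock_space \<alpha>"
    using g(1) by (rule fock_space_cmult)
  have "X (\<lambda>z. f z + - 1 * g z) = (\<lambda>z. X f z + X (\<lambda>z. - 1 * g z) z)"
    using X f ng by (rule bounded_operator_on_add)
  also have "X (\<lambda>z. - 1 * g z) = (\<lambda>z. - 1 * X g z)"
    using X g(1) by (rule bounded_operator_on_cmult)
  finally show ?thesis
    using g(2) by simp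
qed

lemma shifted_monomial_in_fock_space:
  assumes "\<alpha> > 0"
  shows "(\<lambda>z. (z - p) ^ n) \<in> fock_space \<alpha>"
proof -
  have "poly ([:- p, 1:] ^ n) = (\<lambda>z. (z - p) ^ n)"
    by (auto simp: poly_power)
  then show ?thesis
    using polynomial_in_fock_space[OF assms, of "[:- p, 1:] ^ n"] by simp
qed

text \<open>
  Expanding a polynomial in powers of \<open>z - p\<close> writes it as a linear combination of the given
  kernel elements.
\<close>

lemma kernel_contains_polynomials:
  assumes \<alpha>: "\<alpha> > 0" and X: "bounded_operator_on (fock_space \<alpha>) (fock_norm \<alpha>) X"
    and zero: "\<And>n. X (\<lambda>z. (z - p) ^ n) = (\<lambda>z. 0)"
  shows "X (poly P) = (\<lambda>z. 0)"
proof -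
  have "(\<lambda>z. \<Sum>n<N. a n * (z - p) ^ n) \<in> fock_space \<alpha> \<and> X (\<lambda>z. \<Sum>n<N. a n * (z - p) ^ n) = (\<lambda>z. 0)"
    for a :: "nat \<Rightarrow> complex" and N
  proof (induction N)
    case 0
    have "(\<lambda>z. 0) \<in> fock_space \<alpha>"
      by (simp add: fock_space_def)
    moreover from this have "X (\<lambda>z. 0 * 0) = (\<lambda>z. 0 * X (\<lambda>z. 0) z)"
      by (rule bounded_operator_on_cmult[OF X])
    ultimately show ?case
      by simp
  next
    case (Suc N)
    let ?S = "\<lambda>z. \<Sum>n<N. a n * (z - p) ^ n" and ?m = "\<lambda>z. (z - p) ^ N"
    have m: "?m \<in> fock_space \<alpha>"
      using \<alpha> by (rule shifted_monomial_in_fock_space)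
    then have am: "(\<lambda>z. a N * ?m z) \<in> fock_space \<alpha>"
      by (rule fock_space_cmult)
    have "X (\<lambda>z. a N * ?m z) = (\<lambda>z. a N * X ?m z)"
      using X m by (rule bounded_operator_on_cmult)
    moreover have "X (\<lambda>z. ?S z + a N * ?m z) = (\<lambda>z. X ?S z + X (\<lambda>z. a N * ?m z) z)"
      using Suc am by (intro bounded_operator_on_add[OF X]) auto
    moreover have "(\<lambda>z. ?S z + a N * ?m z) \<in> fock_space \<alpha>"
      using Suc am by (intro fock_space_add) auto
    ultimately show ?case
      using Suc zero by simp
  qed
  note span = this
  define Q where "Q = P \<circ>\<^sub>p [:p, 1:]"
  have "poly P z = (\<Sum>n<Suc (degree Q). coeff Q n * (z - p) ^ n)" for z
  proof -
    have "poly P z = poly Q (z - p)"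
      by (simp add: Q_def poly_pcompose)
    then show ?thesis
      by (simp only: poly_altdef lessThan_Suc_atMost)
  qed
  then show ?thesis
    using span[where a = "coeff Q" and N = "Suc (degree Q)"] by presburger
qed

text \<open>
  The kernel contains the dense set of polynomials. Boundedness makes the norm of \<open>X f\<close>
  arbitrarily small, and point evaluation, being bounded as well, turns this into \<open>X f = 0\<close>.
\<close>

lemma bounded_operator_zero_if_zero_on_monomials:
  assumes \<alpha>: "\<alpha> > 0" and X: "bounded_operator_on (fock_space \<alpha>) (fock_norm \<alpha>) X"
    and zero: "\<And>n. X (\<lambda>z. (z - p) ^ n) = (\<lambda>z. 0)"
    and f: "f \<in> fock_space \<alpha>"
  shows "X f = (\<lambda>z. 0)"
proof
  fix z
  have Xf: "X f \<in> fock_space \<alpha>"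
    using X f by (rule bounded_operator_on_closed)
  obtain C where C: "C \<ge> 0" "\<And>g. g \<in> fock_space \<alpha> \<Longrightarrow> cmod (g z) \<le> C * fock_norm \<alpha> g"
    using higher_deriv_functional_bounded[OF \<alpha>, where n = 0 and p = z] by auto
  obtain K where K: "\<And>g. g \<in> fock_space \<alpha> \<Longrightarrow> fock_norm \<alpha> (X g) \<le> K * fock_norm \<alpha> g"
    using X unfolding bounded_operator_on_def by blast
  have "cmod (X f z) \<le> C * \<bar>K\<bar> * \<epsilon>" if \<epsilon>: "\<epsilon> > 0" for \<epsilon>
  proof -
    obtain P where P: "fock_norm \<alpha> (\<lambda>z. f z - poly P z) \<le> \<epsilon>"
      by (rule polynomials_dense_in_fock_space[OF \<alpha> f \<epsilon>])
    have P': "poly P \<in> fock_space \<alpha>" "X (poly P) = (\<lambda>z. 0)"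
      using polynomial_in_fock_space[OF \<alpha>] kernel_contains_polynomials[OF \<alpha> X zero] by auto
    have mem: "(\<lambda>z. f z - poly P z) \<in> fock_space \<alpha>"
      using fock_space_add[OF f fock_space_cmult[OF P'(1), of "- 1"]] by simp
    have "fock_norm \<alpha> (X f) = fock_norm \<alpha> (X (\<lambda>z. f z - poly P z))"
      by (subst bounded_operator_on_diff_of_kernel[where g = "poly P", OF X f]) (use P' in simp_all)
    also have "\<dots> \<le> K * fock_norm \<alpha> (\<lambda>z. f z - poly P z)"
      by (rule K[OF mem])
    also have "\<dots> \<le> \<bar>K\<bar> * \<epsilon>"
      using P by (rule mult_mono[OF abs_ge_self]) (auto simp: fock_norm_nonneg[OF \<alpha>])
    finally have "C * fock_norm \<alpha> (X f) \<le> C * (\<bar>K\<bar> * \<epsilon>)"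
      using C(1) by (rule mult_left_mono)
    with C(2)[OF Xf] show ?thesis
      by (simp add: mult.assoc)
  qed
  then have ev: "\<forall>\<^sub>F \<epsilon> in at_right 0. cmod (X f z) \<le> C * \<bar>K\<bar> * \<epsilon>"
    by (auto simp: eventually_at_filter)
  have lim: "((\<lambda>\<epsilon>. C * \<bar>K\<bar> * \<epsilon>) \<longlongrightarrow> C * \<bar>K\<bar> * 0) (at_right 0)"
    by (intro tendsto_intros)
  have "cmod (X f z) \<le> C * \<bar>K\<bar> * 0"
    using lim ev by (rule tendsto_lowerbound) simp
  then show "X f z = 0"
    by simp
qed

lemma entire_nonzero_higher_deriv:
  assumes "g holomorphic_on UNIV" "g \<noteq> (\<lambda>z. 0)"
  obtains m where "(deriv ^^ m) g p \<noteq> (0::complex)"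
  using assms holomorphic_fun_eq_0_on_connected[of g UNIV p] by fastforce

lemma higher_deriv_composition_operator_fixed_point:
  assumes "f holomorphic_on UNIV" "w * p + b = p" "\<And>z. \<phi> z = w * z + b"
  shows "(deriv ^^ n) (composition_operator \<phi> f) p = w ^ n * (deriv ^^ n) f p"
  using higher_deriv_compose_linear'[OF assms(1) open_UNIV open_UNIV, of p w b n] assms
  by (simp add: composition_operator_def o_def)

theorem theorem3p4:
  fixes \<alpha> :: real and w b :: complex and \<phi> :: "complex \<Rightarrow> complex"
  assumes "\<alpha> > 0"
    and "0 < cmod w" and "cmod w \<le> 1"
    and "cmod w = 1 \<Longrightarrow> b = 0"
    and "\<And>z. \<phi> z = w * z + b"
  shows "Ext (fock_space \<alpha>) (fock_norm \<alpha>) (composition_operator \<phi>) = {w powi n | n :: int. True}"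
proof -
  \<comment> \<open>The fixed point of \<open>\<phi>\<close>; for \<open>w = 1\<close> the division yields \<open>0\<close>, which is fixed because then \<open>b = 0\<close>.\<close>
  define p where "p = b / (1 - w)"
  have w: "w \<noteq> 0"
    using assms(2) by auto
  have p: "w * p + b = p"
  proof (cases "w = 1")
    case True
    then show ?thesis
      using assms(4) by (simp add: p_def)
  next
    case False
    then show ?thesis
      by (simp add: p_def field_simps)
  qed
  let ?H = "fock_space \<alpha>" and ?N = "fock_norm \<alpha>" and ?A = "composition_operator \<phi>"
  define e where "e n z = (z - p) ^ n" for n z
  have e_mem: "e n \<in> ?H" for n
    using shifted_monomial_in_fock_space[OF assms(1), of p n] by (simp add: e_def[abs_def])
  have A_e: "?A (e n) = (\<lambda>z. w ^ n * e n z)" for n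
  proof
    fix z
    have "w * z + b - p = w * (z - p)"
      using p by (simp add: algebra_simps)
    then show "?A (e n) z = w ^ n * e n z"
      by (simp add: composition_operator_def e_def assms(5) power_mult_distrib)
  qed
  note deriv_A = higher_deriv_composition_operator_fixed_point[OF _ p assms(5)]
  show ?thesis
  proof (intro equalityI subsetI)
    fix l assume "l \<in> Ext ?H ?N ?A"
    then obtain X where X: "bounded_operator_on ?H ?N X" and nz: "\<exists>f\<in>?H. X f \<noteq> (\<lambda>x. 0)"
      and comm: "\<And>f. f \<in> ?H \<Longrightarrow> ?A (X f) = (\<lambda>x. l * X (?A f) x)"
      unfolding Ext_def by blast
    obtain n where n: "X (e n) \<noteq> (\<lambda>z. 0)"
      using nz bounded_operator_zero_if_zero_on_monomials[OF assms(1) X, of p]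
      unfolding e_def[abs_def] by blast
    define g where "g = X (e n)"
    have "g \<in> ?H"
      unfolding g_def using X e_mem by (rule bounded_operator_on_closed)
    then have g: "g holomorphic_on UNIV"
      by (rule fock_space_holomorphic)
    have "X (?A (e n)) = (\<lambda>z. w ^ n * g z)"
      unfolding A_e g_def using X e_mem by (rule bounded_operator_on_cmult)
    then have A_g: "?A g = (\<lambda>z. (l * w ^ n) * g z)"
      using comm[OF e_mem[of n]] by (simp add: g_def mult_ac)
    obtain m where m: "(deriv ^^ m) g p \<noteq> 0"
      using entire_nonzero_higher_deriv[OF g, of p] n by (auto simp: g_def)
    have "w ^ m * (deriv ^^ m) g p = (deriv ^^ m) (?A g) p"
      using deriv_A[OF g] by simp
    also have "\<dots> = (l * w ^ n) * (deriv ^^ m) g p"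
      unfolding A_g using g by (intro higher_deriv_cmult[where A = UNIV]) auto
    finally have "w ^ m = l * w ^ n"
      using m by simp
    then have "l = w powi (int m - int n)"
      using w by (simp add: power_int_diff field_simps)
    then show "l \<in> {w powi n | n :: int. True}"
      by blast
  next
    fix l assume "l \<in> {w powi n | n :: int. True}"
    then obtain k :: int where l: "l = w powi k"
      by blast
    \<comment> \<open>The nonnegative exponents satisfy \<open>k = m - n\<close>, the smaller of them being \<open>0\<close>.\<close>
    define m n where "m = nat k" and "n = nat (- k)"
    have l': "l * w ^ n = w ^ m"
      using w by (cases "k \<ge> 0") (auto simp: l m_def n_def power_int_def field_simps)
    define X where "X f z = (deriv ^^ n) f p * e m z" for f z
    obtain C where C: "C \<ge> 0" "\<And>f. f \<in> ?H \<Longrightarrow> cmod ((deriv ^^ n) f p) \<le> C * ?N f"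
      using higher_deriv_functional_bounded[OF assms(1)] by blast
    have "bounded_operator_on ?H ?N X"
      unfolding bounded_operator_on_def
    proof (intro conjI ballI allI exI)
      fix f assume f: "f \<in> ?H"
      show "X f \<in> ?H"
        unfolding X_def[abs_def] using e_mem by (rule fock_space_cmult)
      show "X (\<lambda>z. c * f z) = (\<lambda>z. c * X f z)" for c
        using higher_deriv_cmult[OF fock_space_holomorphic[OF f], of p n c] by (auto simp: X_def)
      show "?N (X f) \<le> (C * ?N (e m)) * ?N f"
        using mult_right_mono[OF C(2)[OF f] fock_norm_nonneg[OF assms(1)], of "e m"]
        unfolding X_def[abs_def] fock_norm_cmult by (simp only: mult_ac)
      fix g assume g: "g \<in> ?H"
      show "X (\<lambda>z. f z + g z) = (\<lambda>z. X f z + X g z)"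
        using higher_deriv_add[OF fock_space_holomorphic[OF f] fock_space_holomorphic[OF g], of p n]
        by (auto simp: X_def distrib_right)
    qed
    moreover have "\<exists>f\<in>?H. X f \<noteq> (\<lambda>z. 0)"
    proof
      have "(deriv ^^ n) (e n) p = fact n"
        by (simp add: e_def[abs_def] higher_deriv_power pochhammer_fact)
      then have "X (e n) (p + 1) \<noteq> 0"
        by (simp add: X_def e_def)
      then show "X (e n) \<noteq> (\<lambda>z. 0)"
        by metis
    qed (rule e_mem)
    moreover have "?A (X f) = (\<lambda>z. l * X (?A f) z)" if f: "f \<in> ?H" for f
    proof
      fix z
      have "?A (X f) z = (deriv ^^ n) f p * ?A (e m) z"
        by (simp add: composition_operator_def X_def)
      then show "?A (X f) z = l * X (?A f) z"
        using deriv_A[OF fock_space_holomorphic[OF f], of n]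
        by (simp add: A_e X_def l'[symmetric])
    qed
    ultimately show "l \<in> Ext ?H ?N ?A"
      unfolding Ext_def by blast
  qed
qed

end
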